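(* There exist a constant $C>0$ and infinitely many positive integers $n$ for which there is a connected cubic (i.e. $3$-regular) graph $G$ on $n$ vertices with $\xi(G) \ge C\, n^{1/6}$. That is, for an infinite number of values of $n$, there exist cubic graphs $G$ on $n$ vertices such that $\xi(G) = \Omega(n^{1/6})$.
   Context: Graphs are finite, simple and undirected. Containment: on a connected graph $G$, $k$ cops are first placed on edges of $G$ (several cops may share an edge), then the robber chooses a vertex. They then alternate turns, cops first, with full information. On the cops' turn each cop stays put or moves to an adjacent edge (an edge sharing an endpoint with her current edge; moving through a vertex occupied by the robber is allowed). On the robber's turn he stays put or moves to an adjacent vertex along an edge not currently occupied by a cop. The cops win (contain the robber) if at some time it is the robber's turn and every edge incident with the robber's vertex is occupied by at least one cop. $G$ is $k$-cop-containable if $k$ cops have a strategy guaranteeing a win, and the containability number $\xi(G)$ is the smallest $k$ such that $G$ is $k$-cop-containable. *)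

theory Defs
  imports Complex_Main
begin

definition simple_graph :: "'a set \<Rightarrow> 'a set set \<Rightarrow> bool" where
  "simple_graph V E \<longleftrightarrow> finite V \<and> (\<forall>e\<in>E. e \<subseteq> V \<and> card e = 2)"

definition connected_graph :: "'a set \<Rightarrow> 'a set set \<Rightarrow> bool" where
  "connected_graph V E \<longleftrightarrow>
     V \<noteq> {} \<and> (\<forall>u\<in>V. \<forall>v\<in>V. (u, v) \<in> {(x, y). {x, y} \<in> E}\<^sup>*)"

definition incident_edges :: "'a set set \<Rightarrow> 'a \<Rightarrow> 'a set set" where
  "incident_edges E v = {e \<in> E. v \<in> e}"

definition cubic_graph :: "'a set \<Rightarrow> 'a set set \<Rightarrow> bool" where
  "cubic_graph V E \<longleftrightarrow> (\<forall>v\<in>V. card (incident_edges E v) = 3)"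

text \<open>
  A strategy \<open>s\<close> of the \<open>k\<close> cops sends the list of all past robber positions (oldest first) to the
  edges the cops occupy next: cop \<open>i < k\<close> starts on \<open>s [] i\<close>, and after the robber has visited
  \<open>h\<close> she is on \<open>s h i\<close>. The cops' own past positions are determined by \<open>s\<close> and the robber's, so
  this is a full-information, history-dependent strategy. Legality is demanded for all \<open>h\<close>, which
  is harmless: on histories that cannot occur the cops may stay put.
\<close>

definition cop_strategy :: "'a set set \<Rightarrow> nat \<Rightarrow> ('a list \<Rightarrow> nat \<Rightarrow> 'a set) \<Rightarrow> bool" where
  "cop_strategy E k s \<longleftrightarrow>
     (\<forall>i<k. s [] i \<in> E) \<and>
     (\<forall>h v. \<forall>i<k. s (h @ [v]) i = s h i \<or>
                   (s (h @ [v]) i \<in> E \<and> s (h @ [v]) i \<inter> s h i \<noteq> {}))"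

text \<open>
  In the play where the robber is at \<open>r t\<close> after his \<open>t\<close>-th move (\<open>r 0\<close> being his initial choice),
  \<open>cops_at s r t\<close> gives the cop positions after \<open>t\<close> cop moves. The order of play is
  \<open>cops_at s r 0\<close>, \<open>r 0\<close>, \<open>cops_at s r 1\<close>, \<open>r 1\<close>, \<open>\<dots>\<close>, so when it is the robber's turn at \<open>r t\<close>
  the cops are at \<open>cops_at s r (Suc t)\<close>.
\<close>

definition cops_at :: "('a list \<Rightarrow> nat \<Rightarrow> 'a set) \<Rightarrow> (nat \<Rightarrow> 'a) \<Rightarrow> nat \<Rightarrow> nat \<Rightarrow> 'a set" where
  "cops_at s r t = s (map r [0..<t])"

definition occupied :: "nat \<Rightarrow> (nat \<Rightarrow> 'a set) \<Rightarrow> 'a set \<Rightarrow> bool" where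
  "occupied k c e \<longleftrightarrow> (\<exists>i<k. c i = e)"

definition robber_play ::
  "'a set \<Rightarrow> 'a set set \<Rightarrow> nat \<Rightarrow> ('a list \<Rightarrow> nat \<Rightarrow> 'a set) \<Rightarrow> (nat \<Rightarrow> 'a) \<Rightarrow> bool" where
  "robber_play V E k s r \<longleftrightarrow>
     r 0 \<in> V \<and>
     (\<forall>t. r (Suc t) = r t \<or>
          ({r t, r (Suc t)} \<in> E \<and>
           \<not> occupied k (cops_at s r (Suc t)) {r t, r (Suc t)}))"

text \<open>
  Since the robber may always stay put, every finite play extends to an infinite one, so it is
  enough to quantify over infinite plays.
\<close>

definition containable :: "'a set \<Rightarrow> 'a set set \<Rightarrow> nat \<Rightarrow> bool" where
  "containable V E k \<longleftrightarrow>
     (\<exists>s. cop_strategy E k s \<and>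
          (\<forall>r. robber_play V E k s r \<longrightarrow>
               (\<exists>t. \<forall>e\<in>incident_edges E (r t). occupied k (cops_at s r (Suc t)) e)))"

definition containability_number :: "'a set \<Rightarrow> 'a set set \<Rightarrow> nat" where
  "containability_number V E = (LEAST k. containable V E k)"

text \<open>The minimum is attained: one cop per edge suffices.\<close>

lemma containable_card_edges:
  assumes "simple_graph V E"
  shows "containable V E (card E)"
proof -
  have "E \<subseteq> Pow V" "finite V"
    using assms by (auto simp: simple_graph_def)
  then have "finite E"
    using finite_subset by blast
  then obtain f where "bij_betw f {0..<card E} E"
    using ex_bij_betw_nat_finite by blast
  then have f: "f ` {0..<card E} = E"
    by (simp add: bij_betw_def)
  have in_E: "f i \<in> E" if "i < card E" for i
    using f that by (metis atLeastLessThan_iff imageI zero_le)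
  have occ: "occupied (card E) f e" if "e \<in> E" for e
    using that unfolding occupied_def by (metis atLeastLessThan_iff f imageE)
  have strat: "cop_strategy E (card E) (\<lambda>h. f)"
    unfolding cop_strategy_def using in_E by blast
  have "\<exists>t. \<forall>e\<in>incident_edges E (r t). occupied (card E) (cops_at (\<lambda>h. f) r (Suc t)) e"
    for r :: "nat \<Rightarrow> 'a"
    unfolding cops_at_def incident_edges_def using occ by blast
  with strat show ?thesis
    unfolding containable_def by blast
qed

end

theory Submission
  imports Defs "HOL-Library.Countable" "HOL-Computational_Algebra.Primes"
begin

text \<open>
  Take a \<open>q\<close>-regular base graph of girth at least five on \<open>2 q\<^sup>2\<close> vertices, replace every vertex by a
  path of \<open>q\<close> ports and every edge by a path of length \<open>4 q + 1\<close> between the two ports, and make the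
  result cubic by joining the vertices of degree two to their twins in a second copy. This graph has
  \<open>O(q\<^sup>4)\<close> vertices. The robber stays in the first copy and runs from one port path to the next. The
  connecting paths are so long that, by the time he has arrived, a cop can only interfere if she
  started on the path he uses or near a base vertex within distance one of his target, and by the
  girth condition each endpoint of her edge rules out at most one target. All other cops stay far
  away or trail behind him. Hence he is never contained by fewer than \<open>(q - 1) / 2\<close> cops.
\<close>

section \<open>Evasion invariants\<close>

text \<open>Containment would block every edge at the robber, so it suffices that he can move at
  every turn. \<open>I\<close> is evaluated just before a cop move, and \<open>c'\<close> is the
  position after it.\<close>

lemma not_containable_if_invariant:
  assumes init: "\<And>c. \<forall>i<k. c i \<in> E \<Longrightarrow> \<exists>r\<in>V. I r c"
    and step: "\<And>r c c'. I r c \<Longrightarrow>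
      \<forall>i<k. c i \<in> E \<and> c' i \<in> E \<and> (c' i = c i \<or> c' i \<inter> c i \<noteq> {}) \<Longrightarrow>
      \<exists>r'. {r, r'} \<in> E \<and> \<not> occupied k c' {r, r'} \<and> I r' c'"
  shows "\<not> containable V E k"
proof
  assume "containable V E k"
  then obtain s where s: "cop_strategy E k s"
    and win: "\<And>r. robber_play V E k s r \<Longrightarrow>
      \<exists>t. \<forall>e\<in>incident_edges E (r t). occupied k (cops_at s r (Suc t)) e"
    unfolding containable_def by blast
  have s0: "\<forall>i<k. s [] i \<in> E"
    using s by (simp add: cop_strategy_def)
  have sstep: "s (h @ [v]) i = s h i \<or> (s (h @ [v]) i \<in> E \<and> s (h @ [v]) i \<inter> s h i \<noteq> {})"
    if "i < k" for h v i
    using s that by (auto simp: cop_strategy_def)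
  have sE: "s h i \<in> E" if "i < k" for h i
    using that
  proof (induction h rule: rev_induct)
    case (snoc x xs)
    then show ?case using sstep[OF \<open>i < k\<close>, of xs x] by auto
  qed (use s0 in auto)
  obtain r0 where r0: "r0 \<in> V" "I r0 (s [])"
    using init[OF s0] by blast
  \<comment> \<open>After a history \<open>h\<close> the cops move from \<open>s (butlast h)\<close>
    to \<open>s h\<close>, so the invariant pairs \<open>last h\<close> with the former.\<close>
  let ?P = "\<lambda>(n::nat) h. h \<noteq> [] \<and> I (last h) (s (butlast h)) \<and> (n = 0 \<longrightarrow> h = [r0])"
  let ?Q = "\<lambda>(n::nat) h h'. \<exists>x. h' = h @ [x] \<and> {last h, x} \<in> E \<and> \<not> occupied k (s h) {last h, x}"
  have "\<exists>h. \<forall>n. ?P n (h n) \<and> ?Q n (h n) (h (Suc n))"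
  proof (rule dependent_nat_choice)
    show "\<exists>h. ?P 0 h"
      using r0 by (intro exI[of _ "[r0]"]) simp
    fix h and n :: nat
    assume h: "?P n h"
    have "\<forall>i<k. s (butlast h) i \<in> E \<and> s h i \<in> E \<and> (s h i = s (butlast h) i \<or> s h i \<inter> s (butlast h) i \<noteq> {})"
      using sE sstep[of _ "butlast h" "last h"] h by (metis append_butlast_last_id)
    then obtain x where "{last h, x} \<in> E" "\<not> occupied k (s h) {last h, x}" "I x (s h)"
      using step h by blast
    then show "\<exists>h'. ?P (Suc n) h' \<and> ?Q n h h'"
      by (intro exI[of _ "h @ [x]"]) simp
  qed
  then obtain h where h: "\<And>n. ?P n (h n)" "\<And>n. ?Q n (h n) (h (Suc n))"
    by blast
  define r where "r n = last (h n)" for n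
  have hist: "map r [0..<Suc n] = h n" for n
  proof (induction n)
    case 0
    then show ?case using h(1)[of 0] by (simp add: r_def)
  next
    case (Suc n)
    have "map r [0..<Suc (Suc n)] = h n @ [r (Suc n)]"
      using Suc by simp
    also have "\<dots> = h (Suc n)"
      using h(2)[of n] by (auto simp: r_def)
    finally show ?case .
  qed
  have move: "{r t, r (Suc t)} \<in> E \<and> \<not> occupied k (cops_at s r (Suc t)) {r t, r (Suc t)}" for t
    using h(2)[of t] unfolding cops_at_def hist by (auto simp: r_def)
  have "robber_play V E k s r"
    unfolding robber_play_def using move h(1)[of 0] r0 by (simp add: r_def)
  then obtain t where "\<forall>e\<in>incident_edges E (r t). occupied k (cops_at s r (Suc t)) e"
    using win by blast
  then show False
    using move[of t] by (auto simp: incident_edges_def)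
qed

section \<open>Transport along injections\<close>

text \<open>A cop strategy on the copy pulls back through preimages of edges. This carries the lower
  bound for the expansion over to its copy on natural numbers.\<close>

lemma containable_image:
  assumes f: "inj f" and cont: "containable (f ` V) ((`) f ` E) k"
  shows "containable V E k"
proof -
  let ?E = "(`) f ` E"
  let ?g = "\<lambda>e. f -` e"
  have inv: "f -` (f ` e) = e" for e
    using f by (simp add: inj_vimage_image_eq)
  have gE: "?g e \<in> E" "f ` ?g e = e" if "e \<in> ?E" for e
    using that inv by auto
  obtain s where s: "cop_strategy ?E k s"
    and win: "\<And>r. robber_play (f ` V) ?E k s r \<Longrightarrow>
      \<exists>t. \<forall>e\<in>incident_edges ?E (r t). occupied k (cops_at s r (Suc t)) e"
    using cont unfolding containable_def by blast
  have sstep: "s (h @ [v]) i = s h i \<or> (s (h @ [v]) i \<in> ?E \<and> s (h @ [v]) i \<inter> s h i \<noteq> {})"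
    if "i < k" for h v i
    using s that by (auto simp: cop_strategy_def)
  have sE: "s h i \<in> ?E" if "i < k" for h i
    using that
  proof (induction h rule: rev_induct)
    case (snoc x xs)
    then show ?case using sstep[OF \<open>i < k\<close>, of xs x] by auto
  qed (use s in \<open>auto simp: cop_strategy_def\<close>)
  define s' where "s' h i = ?g (s (map f h) i)" for h i
  have fs': "f ` s' h i = s (map f h) i" if "i < k" for h i
    unfolding s'_def using gE(2)[OF sE[OF that]] .
  have occ: "occupied k (cops_at s (f \<circ> r) t) (f ` e) \<longleftrightarrow> occupied k (cops_at s' r t) e" for r t e
    unfolding occupied_def cops_at_def using fs'
    by (metis inv map_map)
  have "cop_strategy E k s'"
    unfolding cop_strategy_def
  proof (intro conjI allI impI)
    show "s' [] i \<in> E" if "i < k" for i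
      unfolding s'_def using gE(1)[OF sE[OF that]] .
    fix h v i
    assume i: "i < k"
    have "s' (h @ [v]) i \<in> E"
      unfolding s'_def using gE(1)[OF sE[OF i]] .
    moreover have "s' (h @ [v]) i = s' h i" if "s (map f h @ [f v]) i = s (map f h) i"
      using that by (simp add: s'_def)
    moreover have "s' (h @ [v]) i \<inter> s' h i \<noteq> {}" if "s (map f h @ [f v]) i \<inter> s (map f h) i \<noteq> {}"
    proof -
      have "f ` s' (h @ [v]) i \<inter> f ` s' h i \<noteq> {}"
        using that fs'[OF i] by simp
      then show ?thesis using f by (auto dest: injD)
    qed
    ultimately show "s' (h @ [v]) i = s' h i \<or> (s' (h @ [v]) i \<in> E \<and> s' (h @ [v]) i \<inter> s' h i \<noteq> {})"
      using sstep[OF i, of "map f h" "f v"] by blast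
  qed
  moreover have "\<exists>t. \<forall>e\<in>incident_edges E (r t). occupied k (cops_at s' r (Suc t)) e"
    if r: "robber_play V E k s' r" for r
  proof -
    have "robber_play (f ` V) ?E k s (f \<circ> r)"
      unfolding robber_play_def
    proof (intro conjI allI)
      show "(f \<circ> r) 0 \<in> f ` V"
        using r by (simp add: robber_play_def)
      fix t
      have "r (Suc t) = r t \<or> ({r t, r (Suc t)} \<in> E \<and> \<not> occupied k (cops_at s' r (Suc t)) {r t, r (Suc t)})"
        using r by (simp add: robber_play_def)
      then consider "r (Suc t) = r t"
        | "{r t, r (Suc t)} \<in> E" "\<not> occupied k (cops_at s' r (Suc t)) {r t, r (Suc t)}" by blast
      then show "(f \<circ> r) (Suc t) = (f \<circ> r) t \<or> ({(f \<circ> r) t, (f \<circ> r) (Suc t)} \<in> ?E \<and>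
          \<not> occupied k (cops_at s (f \<circ> r) (Suc t)) {(f \<circ> r) t, (f \<circ> r) (Suc t)})"
      proof cases
        case 2
        have "f ` {r t, r (Suc t)} \<in> ?E"
          using 2(1) by (rule imageI)
        then show ?thesis
          using 2(2) occ[of r "Suc t" "{r t, r (Suc t)}"] by simp
      qed simp
    qed
    then obtain t where t: "\<And>e. e \<in> incident_edges ?E ((f \<circ> r) t) \<Longrightarrow> occupied k (cops_at s (f \<circ> r) (Suc t)) e"
      using win by blast
    have "occupied k (cops_at s' r (Suc t)) e" if "e \<in> incident_edges E (r t)" for e
      using t[of "f ` e"] that occ by (auto simp: incident_edges_def)
    then show ?thesis by blast
  qed
  ultimately show ?thesis
    unfolding containable_def by blast
qed

lemma simple_graph_image:
  assumes "inj f" "simple_graph V E"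
  shows "simple_graph (f ` V) ((`) f ` E)"
proof -
  have "card (f ` e) = card e" for e
    using assms(1) by (meson card_image inj_on_subset subset_UNIV)
  then show ?thesis
    using assms(2) unfolding simple_graph_def by auto
qed

lemma connected_graph_image:
  assumes "connected_graph V E"
  shows "connected_graph (f ` V) ((`) f ` E)"
proof -
  have "(f u, f v) \<in> {(x, y). {x, y} \<in> (`) f ` E}\<^sup>*" if "(u, v) \<in> {(x, y). {x, y} \<in> E}\<^sup>*" for u v
    using that
  proof (induction rule: rtrancl_induct)
    case (step y z)
    then have "f ` {y, z} \<in> (`) f ` E" by blast
    then have "(f y, f z) \<in> {(x, y). {x, y} \<in> (`) f ` E}" by simp
    with step.IH show ?case by (rule rtrancl_into_rtrancl)
  qed simp
  then show ?thesis
    using assms unfolding connected_graph_def by auto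
qed

lemma cubic_graph_image:
  assumes f: "inj f" and "cubic_graph V E"
  shows "cubic_graph (f ` V) ((`) f ` E)"
proof -
  have "incident_edges ((`) f ` E) (f v) = (`) f ` incident_edges E v" for v
    using inj_image_mem_iff[OF f] unfolding incident_edges_def by blast
  moreover have "inj ((`) f)"
    using f by (simp add: inj_image_eq_iff inj_def)
  ultimately show ?thesis
    using assms(2) unfolding cubic_graph_def
    by (auto simp: card_image inj_on_subset)
qed

section \<open>Expansion of a base graph of girth five\<close>

text \<open>
  \<open>nb w c\<close> is the neighbour of \<open>w\<close> behind port \<open>c\<close>, and \<open>pt w c\<close> is the port at which that base edge
  arrives there. The vertex \<open>(w, c, i, z)\<close> of the expansion lies in the copy \<open>z\<close>, at distance \<open>i\<close>
  from \<open>w\<close> on the half-edge of port \<open>c\<close>.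
\<close>

locale expansion =
  fixes B :: "'b set" and q L :: nat and nb :: "'b \<Rightarrow> nat \<Rightarrow> 'b" and pt :: "'b \<Rightarrow> nat \<Rightarrow> nat"
  assumes finite_B: "finite B" and B_nonempty: "B \<noteq> {}"
    and q_ge: "2 \<le> q" and L_ge: "2 * q \<le> L"
    and nb_in: "w \<in> B \<Longrightarrow> c < q \<Longrightarrow> nb w c \<in> B"
    and pt_less: "w \<in> B \<Longrightarrow> c < q \<Longrightarrow> pt w c < q"
    and nb_nb: "w \<in> B \<Longrightarrow> c < q \<Longrightarrow> nb (nb w c) (pt w c) = w"
    and pt_pt: "w \<in> B \<Longrightarrow> c < q \<Longrightarrow> pt (nb w c) (pt w c) = c"
    and nb_neq: "w \<in> B \<Longrightarrow> c < q \<Longrightarrow> nb w c \<noteq> w"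
    and nb_inj: "w \<in> B \<Longrightarrow> c < q \<Longrightarrow> d < q \<Longrightarrow> nb w c = nb w d \<Longrightarrow> c = d"
    and no_triangle: "w \<in> B \<Longrightarrow> b < q \<Longrightarrow> c < q \<Longrightarrow> d < q \<Longrightarrow> nb (nb w b) c \<noteq> nb w d"
    and no_square: "w \<in> B \<Longrightarrow> b < q \<Longrightarrow> c < q \<Longrightarrow> b' < q \<Longrightarrow> c' < q \<Longrightarrow>
      nb (nb w b) c = nb (nb w b') c' \<Longrightarrow> nb (nb w b) c \<noteq> w \<Longrightarrow> b = b'"
    and base_connected: "u \<in> B \<Longrightarrow> v \<in> B \<Longrightarrow> (u, v) \<in> {(x, y). x \<in> B \<and> (\<exists>c<q. y = nb x c)}\<^sup>*"
begin

type_synonym 'c vertex = "'c \<times> nat \<times> nat \<times> bool"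

definition V :: "'b vertex set" where
  "V = B \<times> {..<q} \<times> {..L} \<times> UNIV"

text \<open>The half-edges of a base edge meet at their ends \<open>i = L\<close>, which gives a
  path of \<open>2 * L + 1\<close> edges. The vertices with \<open>i = 0\<close> form the port path;
  its two ends and all vertices with \<open>i > 0\<close> use their third edge for the twin.\<close>

fun outward :: "'b vertex \<Rightarrow> 'b vertex" where
  "outward (w, c, i, z) = (if i < L then (w, c, Suc i, z) else (nb w c, pt w c, L, z))"

fun inward :: "'b vertex \<Rightarrow> 'b vertex" where
  "inward (w, c, i, z) =
    (if 0 < i then (w, c, i - 1, z) else if Suc c < q then (w, Suc c, 0, z) else (w, c, i, \<not> z))"

fun sideward :: "'b vertex \<Rightarrow> 'b vertex" where
  "sideward (w, c, i, z) = (if i = 0 \<and> 0 < c then (w, c - 1, 0, z) else (w, c, i, \<not> z))"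

definition N :: "'b vertex \<Rightarrow> 'b vertex set" where
  "N x = {outward x, inward x, sideward x}"

definition E :: "'b vertex set set" where
  "E = {{x, y} | x y. x \<in> V \<and> y \<in> N x}"

lemma L_pos: "0 < L"
  using q_ge L_ge by simp

lemma V_iff [simp]: "(w, c, i, z) \<in> V \<longleftrightarrow> w \<in> B \<and> c < q \<and> i \<le> L"
  by (auto simp: V_def)

lemma card_V: "card V = 2 * card B * q * Suc L"
  by (simp add: V_def card_cartesian_product algebra_simps)

lemma N_in_V: "x \<in> V \<Longrightarrow> y \<in> N x \<Longrightarrow> y \<in> V"
  using L_pos nb_in pt_less by (cases x) (auto simp: N_def split: if_splits)

lemma N_sym: "x \<in> V \<Longrightarrow> y \<in> N x \<Longrightarrow> x \<in> N y"
  using nb_nb pt_pt L_pos by (cases x) (auto simp: N_def split: if_splits)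

lemma N_irrefl: "x \<in> V \<Longrightarrow> x \<notin> N x"
  using L_pos nb_neq[THEN not_sym] by (cases x) (auto simp: N_def split: if_splits)

lemma card_N: "x \<in> V \<Longrightarrow> card (N x) = 3"
proof -
  assume x: "x \<in> V"
  obtain w c i z where [simp]: "x = (w, c, i, z)" by (cases x)
  have "nb w c \<noteq> w"
    using x nb_neq by simp
  then have "outward x \<noteq> inward x" "outward x \<noteq> sideward x"
    by auto
  moreover have "inward x \<noteq> sideward x"
    using q_ge by (auto split: if_splits)
  ultimately show ?thesis
    by (simp add: N_def)
qed

lemma edge_iff: "{x, y} \<in> E \<longleftrightarrow> x \<in> V \<and> y \<in> N x"
proof
  assume "{x, y} \<in> E"
  then obtain x' y' where "{x, y} = {x', y'}" "x' \<in> V" "y' \<in> N x'"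
    unfolding E_def by blast
  then show "x \<in> V \<and> y \<in> N x"
    using N_sym N_in_V unfolding doubleton_eq_iff by blast
qed (auto simp only: E_def)

lemma edge_cases:
  assumes "e \<in> E"
  obtains x y where "e = {x, y}" "x \<in> V" "y \<in> N x" "y \<in> V" "x \<noteq> y"
  using assms N_in_V N_irrefl unfolding E_def by blast

lemma edge_subset_V: "e \<in> E \<Longrightarrow> e \<subseteq> V"
  by (elim edge_cases) simp

lemma edge_card: "e \<in> E \<Longrightarrow> card e = 2"
  by (elim edge_cases) simp

lemma edge_adjacent: "e \<in> E \<Longrightarrow> x \<in> e \<Longrightarrow> y \<in> e \<Longrightarrow> y = x \<or> y \<in> N x"
  using N_sym by (elim edge_cases) blast

lemma simple_graph: "simple_graph V E"
  using edge_subset_V edge_card finite_B by (simp add: simple_graph_def V_def)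

lemma cubic_graph: "cubic_graph V E"
  unfolding cubic_graph_def
proof
  fix x
  assume x: "x \<in> V"
  have "incident_edges E x = (\<lambda>y. {x, y}) ` N x"
  proof -
    have "e \<in> (\<lambda>y. {x, y}) ` N x" if e: "e \<in> E" "x \<in> e" for e
    proof -
      obtain y where y: "e = {x, y}" "y \<noteq> x"
        using e by (elim edge_cases) blast
      then show ?thesis using edge_iff e by blast
    qed
    moreover have "{x, y} \<in> E" if "y \<in> N x" for y
      using edge_iff x that by blast
    ultimately show ?thesis
      unfolding incident_edges_def by blast
  qed
  moreover have "inj_on (\<lambda>y. {x, y}) (N x)"
    by (auto simp: inj_on_def doubleton_eq_iff)
  ultimately show "card (incident_edges E x) = 3"
    using card_N[OF x] by (simp add: card_image)
qed

section \<open>Connectedness of the expansion\<close>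

definition reach :: "'b vertex \<Rightarrow> 'b vertex \<Rightarrow> bool" where
  "reach x y \<longleftrightarrow> (x, y) \<in> {(x, y). {x, y} \<in> E}\<^sup>*"

lemma reach_refl: "reach x x"
  by (simp add: reach_def)

lemma reach_trans [trans]: "reach x y \<Longrightarrow> reach y z \<Longrightarrow> reach x z"
  unfolding reach_def by (rule rtrancl_trans)

lemma reach_sym: "reach x y \<Longrightarrow> reach y x"
  unfolding reach_def by (rule symD[OF sym_rtrancl]) (simp add: sym_def insert_commute)

lemma reach_edge: "x \<in> V \<Longrightarrow> y \<in> N x \<Longrightarrow> reach x y"
  unfolding reach_def by (rule r_into_rtrancl) (simp add: edge_iff)

lemma reach_port:
  assumes "w \<in> B" "c < q" "i \<le> L"
  shows "reach (w, c, i, z) (w, c, 0, z)"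
  using assms
proof (induction i)
  case (Suc i)
  have "reach (w, c, Suc i, z) (w, c, i, z)"
    using Suc by (intro reach_edge) (simp_all add: N_def)
  also have "reach (w, c, i, z) (w, c, 0, z)"
    using Suc by simp
  finally show ?case .
qed (rule reach_refl)

lemma reach_core:
  assumes "w \<in> B" "c < q"
  shows "reach (w, c, 0, z) (w, 0, 0, z)"
  using assms
proof (induction c)
  case (Suc c)
  have "reach (w, Suc c, 0, z) (w, c, 0, z)"
    using Suc by (intro reach_edge) (simp_all add: N_def)
  also have "reach (w, c, 0, z) (w, 0, 0, z)"
    using Suc by simp
  finally show ?case .
qed (rule reach_refl)

lemma reach_origin: "w \<in> B \<Longrightarrow> c < q \<Longrightarrow> i \<le> L \<Longrightarrow> reach (w, c, i, z) (w, 0, 0, z)"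
  by (rule reach_trans[OF reach_port reach_core])

lemma reach_base:
  assumes "(u, v) \<in> {(x, y). x \<in> B \<and> (\<exists>c<q. y = nb x c)}\<^sup>*"
  shows "reach (u, 0, 0, z) (v, 0, 0, z)"
  using assms
proof (induction rule: rtrancl_induct)
  case (step x y)
  then obtain c where c: "x \<in> B" "c < q" "y = nb x c" by auto
  note step.IH
  also have "reach (x, 0, 0, z) (x, c, L, z)"
    using c by (simp add: reach_sym reach_origin)
  also have "reach (x, c, L, z) (y, pt x c, L, z)"
    using c by (intro reach_edge) (simp_all add: N_def)
  also have "reach (y, pt x c, L, z) (y, 0, 0, z)"
    using c nb_in pt_less by (intro reach_origin) simp_all
  finally show ?case .
qed (rule reach_refl)

lemma connected_graph: "connected_graph V E"
  unfolding connected_graph_def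
proof (intro conjI ballI)
  show "V \<noteq> {}"
    using B_nonempty q_ge by (auto simp: V_def lessThan_empty_iff)
  fix x y
  assume xy: "x \<in> V" "y \<in> V"
  obtain w c i z where x: "x = (w, c, i, z)" by (cases x)
  obtain w' c' i' z' where y: "y = (w', c', i', z')" by (cases y)
  have "reach x (w, 0, 0, z)"
    using xy x by (simp add: reach_origin)
  also have "reach (w, 0, 0, z) (w, 0, 0, z')"
  proof (cases "z = z'")
    case True
    then show ?thesis by (simp add: reach_refl)
  next
    case False
    then have "z' = (\<not> z)" by blast
    then show ?thesis
      using xy x by (intro reach_edge) (simp_all add: N_def)
  qed
  also have "reach (w, 0, 0, z') (w', 0, 0, z')"
    using reach_base base_connected xy x y by simp
  also have "reach (w', 0, 0, z') y"
    using xy y by (simp add: reach_origin reach_sym)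
  finally show "(x, y) \<in> {(x, y). {x, y} \<in> E}\<^sup>*"
    unfolding reach_def .
qed

section \<open>The truncated distance to a base vertex\<close>

text \<open>Subtraction on \<open>nat\<close> truncates, so this is the absolute difference, the
  number of steps along a port path.\<close>

definition gap :: "nat \<Rightarrow> nat \<Rightarrow> nat" where
  "gap c d = (c - d) + (d - c)"

text \<open>Distance to the port path of \<open>u\<close>, with the copy ignored; \<open>d\<close>
  is the port of \<open>w\<close> facing \<open>u\<close>. At a neighbour \<open>w\<close> of
  \<open>u\<close>, each half-edge not leading to \<open>u\<close> reaches the cap
  \<open>3 * L + 2\<close> at its end \<open>i = L\<close>, since \<open>gap c d\<close> is at least
  one. So everything further out can be given the cap.\<close>

fun dst :: "'b \<Rightarrow> 'b vertex \<Rightarrow> nat" where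
  "dst u (w, c, i, z) =
    (if w = u then i
     else if \<exists>d<q. nb w d = u then
       (let d = (THE d. d < q \<and> nb w d = u) in
        if c = d then 2 * L + 1 - i else min (2 * L + 1 + gap c d + i) (3 * L + 2))
     else 3 * L + 2)"

declare dst.simps [simp del]

lemma dst_self: "dst u (u, c, i, z) = i"
  by (simp add: dst.simps)

lemma dst_adjacent:
  assumes "w \<in> B" "d < q" "nb w d = u"
  shows "dst u (w, c, i, z) =
    (if c = d then 2 * L + 1 - i else min (2 * L + 1 + gap c d + i) (3 * L + 2))"
proof -
  have "(THE d. d < q \<and> nb w d = u) = d"
    using assms nb_inj by (intro the_equality) auto
  moreover have "w \<noteq> u" "\<exists>d<q. nb w d = u"
    using assms nb_neq by blast+
  ultimately show ?thesis
    by (simp add: dst.simps)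
qed

lemma dst_far: "w \<noteq> u \<Longrightarrow> \<forall>d<q. nb w d \<noteq> u \<Longrightarrow> dst u (w, c, i, z) = 3 * L + 2"
  by (auto simp: dst.simps)

lemma dst_le:
  assumes "x \<in> V"
  shows "dst u x \<le> 3 * L + 2"
proof -
  obtain w c i z where "x = (w, c, i, z)" by (cases x)
  then show ?thesis
    using assms by (auto simp: dst.simps Let_def)
qed

text \<open>Unless the base edge is incident with \<open>u\<close>, its middle edge starts at the
  cap already.\<close>

lemma dst_link:
  assumes "w \<in> B" "c < q"
  shows "dst u (nb w c, pt w c, L, z) \<le> dst u (w, c, L, z) + 1"
proof -
  consider "w = u" | "nb w c = u" | d where "w \<noteq> u" "nb w c \<noteq> u" "d < q" "nb w d = u"
    | "w \<noteq> u" "nb w c \<noteq> u" "\<forall>d<q. nb w d \<noteq> u" by blast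
  then show ?thesis
  proof cases
    case 1
    then show ?thesis
      using assms nb_in pt_less nb_nb
      by (simp add: dst_self dst_adjacent[of "nb u c" "pt u c"])
  next
    case 2
    then show ?thesis
      using dst_self[of u "pt w c" L z] dst_adjacent[OF assms] by simp
  next
    case 3
    then have "c \<noteq> d" by auto
    then have "dst u (w, c, L, z) = 3 * L + 2"
      using 3 assms by (simp add: dst_adjacent[of w d] gap_def)
    then show ?thesis
      using assms nb_in pt_less dst_le[of "(nb w c, pt w c, L, z)" u] by simp
  next
    case 4
    then have "dst u (w, c, L, z) = 3 * L + 2"
      by (simp add: dst_far)
    then show ?thesis
      using assms nb_in pt_less dst_le[of "(nb w c, pt w c, L, z)" u] by simp
  qed
qed

text \<open>Moves at one base vertex are read off the formula, and crossing to another is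
  \<open>dst_link\<close>. As adjacency is symmetric, a cop gains at most one per move.\<close>

lemma dst_step:
  assumes x: "x \<in> V" and y: "y \<in> N x"
  shows "dst u y \<le> dst u x + 1"
proof -
  obtain w c i z where [simp]: "x = (w, c, i, z)" by (cases x)
  consider "w = u" | d where "w \<noteq> u" "d < q" "nb w d = u" | "w \<noteq> u" "\<forall>d<q. nb w d \<noteq> u" by blast
  then show ?thesis
  proof cases
    case 1
    then show ?thesis
      using x y L_pos dst_link[of w c u] by (auto simp: N_def dst_self split: if_splits)
  next
    case 2
    have dst: "dst u (w, c', i', z') =
        (if c' = d then 2 * L + 1 - i' else min (2 * L + 1 + gap c' d + i') (3 * L + 2))" for c' i' z'
      using x 2 by (intro dst_adjacent) simp_all
    show ?thesis
      using x y L_pos dst_link[of w c u] by (auto simp: N_def dst gap_def split: if_splits)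
  next
    case 3
    then show ?thesis
      using x y L_pos dst_link[of w c u]
      by (auto simp: N_def dst_far split: if_splits)
  qed
qed

section \<open>The robber's strategy\<close>

text \<open>Here \<open>m\<close> is the distance the robber still has to run to reach the port path of \<open>nb v b\<close>.\<close>

definition on_path :: "'b \<Rightarrow> nat \<Rightarrow> nat \<Rightarrow> 'b vertex \<Rightarrow> bool" where
  "on_path v b m r \<longleftrightarrow>
     (\<exists>c<q. r = (v, c, 0, True) \<and> m = 2 * L + 1 + gap c b) \<or>
     (\<exists>i\<le>L. r = (v, b, i, True) \<and> m = 2 * L + 1 - i) \<or>
     (\<exists>i\<le>L. r = (nb v b, pt v b, i, True) \<and> m = i)"

text \<open>Any exit from this region other than the port the robber is heading for lies at the far
  end of another half-edge of \<open>v\<close>.\<close>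

definition trail :: "'b \<Rightarrow> nat \<Rightarrow> 'b vertex set" where
  "trail v b = {(w, c, i, z). w = v \<or> (w = nb v b \<and> c = pt v b)}"

text \<open>
  A cop in the trail can only follow the robber. The others must keep a larger distance, because on
  arrival they may be at any other port of \<open>nb v b\<close>.
\<close>

definition behind :: "'b \<Rightarrow> nat \<Rightarrow> nat \<Rightarrow> 'b vertex \<Rightarrow> bool" where
  "behind v b m x \<longleftrightarrow>
     m + 2 \<le> dst (nb v b) x \<and> (x \<notin> trail v b \<longrightarrow> q + m \<le> dst (nb v b) x)"

lemma on_path_dst:
  assumes "v \<in> B" "b < q" "on_path v b m r"
  shows "r \<in> V" "dst (nb v b) r = m"
proof -
  show "r \<in> V"
    using assms nb_in pt_less by (auto simp: on_path_def)
  \<comment> \<open>The robber's own route never exceeds the cap, so truncation does not affect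
    him.\<close>
  have "gap c b + 2 * L + 1 \<le> 3 * L + 2" if "c < q" for c
    using that assms(2) L_ge by (simp add: gap_def)
  then show "dst (nb v b) r = m"
    using assms by (auto simp: on_path_def dst_self dst_adjacent[of v b] gap_def)
qed

lemma on_path_core: "c < q \<Longrightarrow> m = 2 * L + 1 + gap c b \<Longrightarrow> on_path v b m (v, c, 0, True)"
  unfolding on_path_def by blast

lemma on_path_out: "i \<le> L \<Longrightarrow> m = 2 * L + 1 - i \<Longrightarrow> on_path v b m (v, b, i, True)"
  unfolding on_path_def by blast

lemma on_path_in: "i \<le> L \<Longrightarrow> on_path v b i (nb v b, pt v b, i, True)"
  unfolding on_path_def by blast

lemma on_path_step:
  assumes "b < q" "on_path v b (Suc m) r"
  shows "\<exists>r'\<in>N r. on_path v b m r'"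
proof -
  consider c where "c < q" "r = (v, c, 0, True)" "Suc m = 2 * L + 1 + gap c b"
    | i where "i \<le> L" "r = (v, b, i, True)" "Suc m = 2 * L + 1 - i"
    | i where "i \<le> L" "r = (nb v b, pt v b, i, True)" "Suc m = i"
    using assms(2) unfolding on_path_def by blast
  then show ?thesis
  proof cases
    case (1 c)
    consider "c < b" | "c = b" | "b < c" by linarith
    then show ?thesis
    proof cases
      case 1
      show ?thesis
        using \<open>c < b\<close> \<open>r = _\<close> \<open>Suc m = _\<close> assms
        by (intro bexI[of _ "(v, Suc c, 0, True)"] on_path_core) (simp_all add: N_def gap_def)
    next
      case 2
      show ?thesis
        using \<open>c = b\<close> \<open>r = _\<close> \<open>Suc m = _\<close> L_pos
        by (intro bexI[of _ "(v, b, 1, True)"] on_path_out) (simp_all add: N_def gap_def)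
    next
      case 3
      show ?thesis
        using \<open>b < c\<close> \<open>c < q\<close> \<open>r = _\<close> \<open>Suc m = _\<close>
        by (intro bexI[of _ "(v, c - 1, 0, True)"] on_path_core) (simp_all add: N_def gap_def)
    qed
  next
    case (2 i)
    show ?thesis
    proof (cases "i < L")
      case True
      then show ?thesis
        using 2 by (intro bexI[of _ "(v, b, Suc i, True)"] on_path_out) (simp_all add: N_def)
    next
      case False
      then have "m = L" using 2 by simp
      then show ?thesis
        using 2 False on_path_in[of L v b]
        by (intro bexI[of _ "(nb v b, pt v b, L, True)"]) (simp_all add: N_def)
    qed
  next
    case (3 i)
    then show ?thesis
      using on_path_in[of m v b] by (intro bexI[of _ "(nb v b, pt v b, m, True)"]) (auto simp: N_def)
  qed
qed

lemma on_path_end: "on_path v b 0 r \<Longrightarrow> r = (nb v b, pt v b, 0, True)"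
  by (auto simp: on_path_def)

text \<open>By \<open>dst_step\<close> both bounds survive, since \<open>m\<close> drops along with
  the cop's gain. The case to check is a cop leaving the trail, where the stronger bound must be met
  afresh.\<close>

lemma behind_step:
  assumes v: "v \<in> B" "b < q" and m: "m \<le> 2 * L + q" and x: "x \<in> V"
    and beh: "behind v b (Suc m) x" and y: "y = x \<or> y \<in> N x"
  shows "behind v b m y"
proof -
  let ?u = "nb v b"
  have "?u \<noteq> v" using nb_neq v by blast
  have d: "dst ?u x \<le> dst ?u y + 1"
    using y dst_step N_sym N_in_V x by (metis le_add1)
  have "q + m \<le> dst ?u y" if yt: "y \<notin> trail v b"
  proof (cases "x \<in> trail v b")
    case False
    then show ?thesis using beh d by (simp add: behind_def)
  next
    case True
    obtain w c i z where xx: "x = (w, c, i, z)" by (cases x)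
    have dx: "Suc m + 2 \<le> dst ?u x" using beh by (simp add: behind_def)
    have "y \<in> N x" using y yt True by blast
    consider "w = v" | "w = ?u" "c = pt v b" using True xx by (auto simp: trail_def)
    then show ?thesis
    proof cases
      case 1
      \<comment> \<open>The exit is the middle edge of another port of \<open>v\<close>. By
        \<open>no_triangle\<close> the base vertex behind it is not adjacent to \<open>?u\<close>,
        so the cop is at the cap, and \<open>2 * q \<le> L\<close> makes the cap at least
        \<open>q + m\<close>.\<close>
      then have yy: "i = L" "y = (nb v c, pt v c, L, z)"
        using \<open>y \<in> N x\<close> yt xx x by (auto simp: N_def trail_def split: if_splits)
      then have c: "c < q" "c \<noteq> b"
        using x xx yt by (auto simp: trail_def)
      have "nb v c \<noteq> ?u" using c v nb_inj by blast
      moreover have "\<forall>d<q. nb (nb v c) d \<noteq> ?u" using no_triangle v c by blast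
      ultimately have "dst ?u y = 3 * L + 2"
        using yy by (simp add: dst_far)
      then show ?thesis using m L_ge by simp
    next
      case 2
      \<comment> \<open>On the arriving half-edge the only exit is the port itself at
        \<open>i = 0\<close>, which is too close to \<open>?u\<close>.\<close>
      then have "i \<noteq> 0" using dx xx by (auto simp: dst_self)
      then have False
        using \<open>y \<in> N x\<close> yt xx x 2 v nb_nb by (auto simp: N_def trail_def split: if_splits)
      then show ?thesis ..
    qed
  qed
  then show ?thesis
    using beh d by (simp add: behind_def)
qed

section \<open>Choice of the next target\<close>

text \<open>What \<open>behind\<close> with \<open>m = 0\<close> leaves when the robber arrives at
  port \<open>a\<close> of \<open>v\<close>: only on the arriving half-edge, which belongs to the
  trail, may a cop be as near as distance two.\<close>

definition clear :: "'b \<Rightarrow> nat \<Rightarrow> 'b vertex \<Rightarrow> bool" where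
  "clear v a x \<longleftrightarrow> (case x of (w, c, i, z) \<Rightarrow> w = v \<longrightarrow> q \<le> i \<or> (c = a \<and> 2 \<le> i))"

lemma clear_if_behind:
  assumes "v \<in> B" "b < q" "behind v b 0 x"
  shows "clear (nb v b) (pt v b) x"
  using assms nb_neq by (cases x) (auto simp: clear_def behind_def trail_def dst_self)

text \<open>The case \<open>w = v\<close> needs its own rule because \<open>v\<close> is adjacent to
  every target \<open>nb v b\<close>; there \<open>clear\<close> takes care of all half-edges but
  the one to be run along.\<close>

definition threatened :: "'b \<Rightarrow> 'b vertex \<Rightarrow> nat set" where
  "threatened v x = (case x of (w, c, i, z) \<Rightarrow>
     {b. b < q \<and> (if w = v then b = c else w = nb v b \<or> (\<exists>d<q. w = nb (nb v b) d))})"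

text \<open>Two threatened ports would lie on a base cycle of length at most four.\<close>

lemma card_threatened:
  assumes "v \<in> B"
  shows "finite (threatened v x)" "card (threatened v x) \<le> 1"
proof -
  obtain w c i z where x: "x = (w, c, i, z)" by (cases x)
  show fin: "finite (threatened v x)"
    by (rule finite_subset[of _ "{..<q}"]) (auto simp: threatened_def x)
  have "b = b'" if "b \<in> threatened v x" "b' \<in> threatened v x" for b b'
  proof (cases "w = v")
    case True
    then show ?thesis using that by (simp add: threatened_def x)
  next
    case False
    then have b: "b < q" "b' < q" and w: "w = nb v b \<or> (\<exists>d<q. w = nb (nb v b) d)"
      and w': "w = nb v b' \<or> (\<exists>d<q. w = nb (nb v b') d)"
      using that by (simp_all add: threatened_def x)
    from w show ?thesis
    proof (elim disjE exE conjE)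
      assume "w = nb v b"
      moreover have "w \<noteq> nb (nb v b') d" if "d < q" for d
        using no_triangle[OF assms b(2) that b(1)] \<open>w = nb v b\<close> by simp
      ultimately show ?thesis
        using w' nb_inj[OF assms b] by blast
    next
      fix d assume d: "d < q" "w = nb (nb v b) d"
      then have "w \<noteq> nb v b'"
        using no_triangle[OF assms b(1) d(1) b(2)] by simp
      then obtain d' where "d' < q" "w = nb (nb v b') d'"
        using w' by blast
      then show ?thesis
        using no_square[OF assms b(1) d(1) b(2)] d False by simp
    qed
  qed
  then show "card (threatened v x) \<le> 1"
    using fin by (simp add: card_le_Suc0_iff_eq)
qed

text \<open>At \<open>v\<close> the cop must first return to the port path, and \<open>clear\<close>
  then keeps her at least two steps behind the robber. Elsewhere \<open>w\<close> is neither the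
  target nor adjacent to it, so the distance is the cap.\<close>

lemma behind_if_not_threatened:
  assumes v: "v \<in> B" and ab: "a < q" "b < q" and x: "x \<in> V" "clear v a x" "b \<notin> threatened v x"
  shows "behind v b (2 * L + 1 + gap a b) x"
proof -
  obtain w c i z where xx: "x = (w, c, i, z)" by (cases x)
  let ?u = "nb v b"
  have gab: "gap a b < q" using ab by (simp add: gap_def)
  show ?thesis
  proof (cases "w = v")
    case True
    then have "c \<noteq> b" "q \<le> i \<or> (c = a \<and> 2 \<le> i)"
      using x ab by (auto simp: clear_def threatened_def xx)
    then have "2 * L + 1 + gap a b + 2 \<le> dst ?u x"
      using True v ab gab xx L_ge q_ge by (auto simp: dst_adjacent[of v b] gap_def)
    moreover have "x \<in> trail v b" using True xx by (simp add: trail_def)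
    ultimately show ?thesis by (simp add: behind_def)
  next
    case False
    then have "w \<noteq> ?u" "\<forall>d<q. w \<noteq> nb ?u d"
      using x ab by (auto simp: threatened_def xx)
    moreover have "\<forall>d<q. nb w d \<noteq> ?u"
    proof (intro allI impI notI)
      fix d assume "d < q" "nb w d = ?u"
      then have "w = nb ?u (pt w d)" "pt w d < q"
        using nb_nb[of w d] pt_less x xx by auto
      then show False using \<open>\<forall>d<q. w \<noteq> nb ?u d\<close> by blast
    qed
    ultimately have "dst ?u x = 3 * L + 2"
      using xx by (simp add: dst_far)
    then show ?thesis using gab L_ge q_ge by (simp add: behind_def)
  qed
qed

section \<open>The evasion invariant\<close>

text \<open>The longest run has \<open>2 * L + q\<close> steps: \<open>q - 1\<close> along the port
  path and \<open>2 * L + 1\<close> to the target. Writing the rest of the run as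
  \<open>Suc m\<close> leaves a step to make at every turn.\<close>

definition evading :: "nat \<Rightarrow> 'b vertex \<Rightarrow> (nat \<Rightarrow> 'b vertex set) \<Rightarrow> bool" where
  "evading k r c \<longleftrightarrow> (\<exists>v\<in>B. \<exists>b<q. \<exists>m. m < 2 * L + q \<and> on_path v b (Suc m) r \<and>
     (\<forall>i<k. \<forall>x\<in>c i. behind v b (Suc m) x))"

lemma evading_restart:
  assumes k: "2 * k + 1 < q" and v: "v \<in> B" "a < q"
    and c: "\<forall>i<k. c i \<in> E" "\<forall>i<k. \<forall>x\<in>c i. clear v a x"
  shows "evading k (v, a, 0, True) c"
proof -
  define X where "X = (\<Union>i<k. c i)"
  have ci: "finite (c i)" "card (c i) = 2" "c i \<subseteq> V" if "i < k" for i
    using that c(1) edge_card edge_subset_V by (auto intro: card_ge_0_finite)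
  have finX: "finite X"
    using ci by (auto simp: X_def)
  have "card X \<le> (\<Sum>i<k. card (c i))"
    unfolding X_def by (rule card_UN_le) simp
  also have "\<dots> = 2 * k" using ci by simp
  finally have "card X \<le> 2 * k" .
  have "card (\<Union>x\<in>X. threatened v x) \<le> (\<Sum>x\<in>X. card (threatened v x))"
    using finX by (rule card_UN_le)
  also have "\<dots> \<le> (\<Sum>x\<in>X. 1)"
    using card_threatened v by (intro sum_mono) blast
  finally have le: "card (\<Union>x\<in>X. threatened v x) \<le> 2 * k"
    using \<open>card X \<le> 2 * k\<close> by simp
  \<comment> \<open>The \<open>2 * k\<close> cop endpoints threaten at most one port each; together
    with \<open>a\<close> this excludes at most \<open>2 * k + 1 < q\<close> ports.\<close>
  have "card (insert a (\<Union>x\<in>X. threatened v x)) < card {..<q}"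
    using le k card_insert_le_m1[of "Suc (2 * k)" "\<Union>x\<in>X. threatened v x" a] by simp
  moreover have "finite (insert a (\<Union>x\<in>X. threatened v x))"
    using finX card_threatened v by simp
  ultimately have "\<not> {..<q} \<subseteq> insert a (\<Union>x\<in>X. threatened v x)"
    by (meson card_mono leD)
  then obtain b where b: "b < q" "b \<noteq> a" "\<forall>x\<in>X. b \<notin> threatened v x"
    by auto
  have "behind v b (2 * L + 1 + gap a b) x" if "i < k" "x \<in> c i" for i x
  proof (rule behind_if_not_threatened[OF v b(1)])
    show "x \<in> V" using ci(3) that by blast
    show "clear v a x" using c(2) that by blast
    show "b \<notin> threatened v x" using b(3) that by (auto simp: X_def)
  qed
  moreover have "on_path v b (2 * L + 1 + gap a b) (v, a, 0, True)"
    using v by (auto simp: on_path_def)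
  moreover have "2 * L + gap a b < 2 * L + q"
    using b v by (simp add: gap_def)
  ultimately show ?thesis
    using v b unfolding evading_def
    by (intro bexI[of _ v] exI[of _ b] conjI exI[of _ "2 * L + gap a b"]) simp_all
qed

lemma evading_step:
  assumes k: "2 * k + 1 < q" and ev: "evading k r c"
    and c: "\<forall>i<k. c i \<in> E \<and> c' i \<in> E \<and> (c' i = c i \<or> c' i \<inter> c i \<noteq> {})"
  shows "\<exists>r'. {r, r'} \<in> E \<and> \<not> occupied k c' {r, r'} \<and> evading k r' c'"
proof -
  obtain v b m where v: "v \<in> B" "b < q" and m: "m < 2 * L + q" and r: "on_path v b (Suc m) r"
    and beh: "\<forall>i<k. \<forall>x\<in>c i. behind v b (Suc m) x"
    using ev by (auto simp: evading_def)
  obtain r' where r': "r' \<in> N r" "on_path v b m r'"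
    using on_path_step v(2) r by blast
  have beh': "behind v b m y" if i: "i < k" and y: "y \<in> c' i" for i y
  proof -
    \<comment> \<open>A common vertex of the old and the new edge covers both staying and moving:
      every endpoint of the new edge is at most one step from it.\<close>
    obtain x where x: "x \<in> c i" "x \<in> c' i"
      using c i y by (metis disjoint_iff)
    then have "x \<in> V" "y = x \<or> y \<in> N x"
      using c i y edge_subset_V edge_adjacent by blast+
    then show ?thesis
      using behind_step[OF v, of m x y] m beh i x by auto
  qed
  have "{r, r'} \<in> E"
    unfolding edge_iff using on_path_dst(1)[OF v r] r'(1) ..
  moreover have "\<not> occupied k c' {r, r'}"
  proof
    assume "occupied k c' {r, r'}"
    then obtain i where "i < k" "r' \<in> c' i"
      unfolding occupied_def by blast
    \<comment> \<open>The endpoint \<open>r'\<close> is at distance \<open>m\<close>, but cop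
      endpoints are at distance at least \<open>m + 2\<close>.\<close>
    then show False
      using beh' on_path_dst(2)[OF v r'(2)] by (fastforce simp: behind_def)
  qed
  moreover have "evading k r' c'"
  proof (cases m)
    \<comment> \<open>The robber has just arrived at the port path of \<open>nb v b\<close>; a new
      run is fixed before the cops move again.\<close>
    case 0
    then have "r' = (nb v b, pt v b, 0, True)"
      using r' on_path_end by blast
    moreover have "\<forall>i<k. \<forall>x\<in>c' i. clear (nb v b) (pt v b) x"
      using clear_if_behind[OF v] beh' unfolding 0 by blast
    moreover have "\<forall>i<k. c' i \<in> E"
      using c by blast
    ultimately show ?thesis
      using evading_restart[OF k nb_in[OF v] pt_less[OF v], of c'] by simp
  next
    case (Suc m')
    then show ?thesis
      unfolding evading_def using v m r'(2) beh'
      by (intro bexI[of _ v] exI[of _ b] conjI exI[of _ m']) simp_all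
  qed
  ultimately show ?thesis by blast
qed

lemma evading_init:
  assumes k: "2 * k + 1 < q" "q \<le> card B" and c: "\<forall>i<k. c i \<in> E"
  shows "\<exists>r\<in>V. evading k r c"
proof -
  define X where "X = (\<Union>i<k. c i)"
  have ci: "finite (c i)" "card (c i) = 2" if "i < k" for i
    using that c edge_card by (auto intro: card_ge_0_finite)
  have "card X \<le> (\<Sum>i<k. card (c i))"
    unfolding X_def by (rule card_UN_le) simp
  also have "\<dots> = 2 * k" using ci by simp
  finally have "card X \<le> 2 * k" .
  moreover have "finite X" using ci by (auto simp: X_def)
  \<comment> \<open>The fewer than \<open>q\<close> cop endpoints miss some base vertex
    \<open>v\<close>. There \<open>clear\<close> holds vacuously, so any port may act as the arrival
    port; \<open>0\<close> is taken.\<close>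
  ultimately have "card (fst ` X) < card B"
    using k card_image_le[of X fst] by linarith
  then have "\<not> B \<subseteq> fst ` X"
    using \<open>finite X\<close> by (meson card_mono finite_imageI leD)
  then obtain v where v: "v \<in> B" "v \<notin> fst ` X" by blast
  have "clear v 0 x" if "x \<in> X" for x
    using v(2) that by (cases x) (force simp: clear_def)
  then have "\<forall>i<k. \<forall>x\<in>c i. clear v 0 x"
    unfolding X_def by blast
  then have "evading k (v, 0, 0, True) c"
    using evading_restart[of k v 0 c] k v c q_ge by simp
  then show ?thesis
    using v q_ge by (intro bexI[of _ "(v, 0, 0, True)"]) simp_all
qed

lemma not_containable:
  assumes "2 * k + 1 < q" "q \<le> card B"
  shows "\<not> containable V E k"
  using evading_init[OF assms] evading_step[OF assms(1)] by (rule not_containable_if_invariant)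

end

section \<open>A base graph over a prime field\<close>

text \<open>The bipartite double cover of the relation \<open>b + b' = a a'\<close> between points \<open>(a, b)\<close> and \<open>(a', b')\<close> of the affine plane.\<close>

definition plane :: "nat \<Rightarrow> (bool \<times> nat \<times> int) set" where
  "plane q = UNIV \<times> {..<q} \<times> {0..<int q}"

definition plane_nb :: "nat \<Rightarrow> bool \<times> nat \<times> int \<Rightarrow> nat \<Rightarrow> bool \<times> nat \<times> int" where
  "plane_nb q w c = (case w of (s, a, b) \<Rightarrow> (\<not> s, c, (int a * int c - b) mod int q))"

text \<open>A neighbour is addressed by its first coordinate, so the way back to \<open>w\<close>
  uses the first coordinate of \<open>w\<close>.\<close>

definition plane_pt :: "bool \<times> nat \<times> int \<Rightarrow> nat \<Rightarrow> nat" where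
  "plane_pt w c = fst (snd w)"

text \<open>Basis of both the absence of squares and connectedness: the sign change of
  \<open>b\<close> cancels after two steps.\<close>

lemma plane_nb_nb:
  "plane_nb q (plane_nb q (s, a, b) c) d = (s, d, (b + int c * (int d - int a)) mod int q)"
  by (simp add: plane_nb_def mod_simps algebra_simps)

text \<open>Two middle vertices give \<open>(c - c') * (d - a) = 0\<close> modulo the prime
  \<open>q\<close>, and \<open>d = a\<close> would mean a return to the start.\<close>

lemma plane_no_square:
  assumes q: "prime q" and less: "c < q" "c' < q" "a < q" "d < q" and b: "b \<in> {0..<int q}"
    and eq: "plane_nb q (plane_nb q (s, a, b) c) d = plane_nb q (plane_nb q (s, a, b) c') d'"
    and neq: "plane_nb q (plane_nb q (s, a, b) c) d \<noteq> (s, a, b)"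
  shows "c = c'"
proof -
  have "d = d'" "(b + int c * (int d - int a)) mod int q = (b + int c' * (int d - int a)) mod int q"
    using eq by (auto simp: plane_nb_nb)
  then have "int q dvd (b + int c * (int d - int a)) - (b + int c' * (int d - int a))"
    by (simp add: mod_eq_dvd_iff)
  also have "\<dots> = (int c - int c') * (int d - int a)"
    by (simp add: algebra_simps)
  finally have "int q dvd int c - int c' \<or> int q dvd int d - int a"
    using q by (simp add: prime_dvd_mult_iff)
  moreover have "x = y" if "int q dvd int x - int y" "x < q" "y < q" for x y
    using that by (simp add: mod_eq_dvd_iff[symmetric])
  moreover have "d \<noteq> a"
    using neq b by (auto simp: plane_nb_nb)
  ultimately show ?thesis using less by blast
qed

text \<open>On one side, a double step through \<open>c = 0\<close> adjusts the first coordinate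
  alone; a second one, changing it by one, then reaches any second coordinate. A single step
  switches sides.\<close>

lemma plane_connected:
  assumes "1 < q" "u \<in> plane q" "v \<in> plane q"
  shows "(u, v) \<in> {(x, y). x \<in> plane q \<and> (\<exists>c<q. y = plane_nb q x c)}\<^sup>*" (is "_ \<in> ?R\<^sup>*")
proof -
  have in_plane: "plane_nb q x c \<in> plane q" if "c < q" for x c
    using that assms(1) by (auto simp: plane_nb_def plane_def split: prod.splits)
  have nb: "(x, plane_nb q x c) \<in> ?R\<^sup>*" if "x \<in> plane q" "c < q" for x c
    using that by blast
  have two: "(x, plane_nb q (plane_nb q x c) d) \<in> ?R\<^sup>*" if "x \<in> plane q" "c < q" "d < q" for x c d
    using nb[OF that(1,2)] nb[OF in_plane that(3)] that by (meson rtrancl_trans)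
  have same_side: "((s, a, b), (s, a', b')) \<in> ?R\<^sup>*"
    if "(s, a, b) \<in> plane q" "(s, a', b') \<in> plane q" for s a b a' b'
  proof -
    \<comment> \<open>\<open>d\<close> differs from \<open>a'\<close> by exactly one, so \<epsilon>
      is its own inverse and \<open>c\<close> is found without division.\<close>
    define d where "d = (if a' = 0 then 1 else a' - 1)"
    have d: "d < q" using that assms(1) by (auto simp: d_def plane_def)
    define \<epsilon> where "\<epsilon> = int a' - int d"
    have eps: "\<epsilon> * \<epsilon> = 1" by (auto simp: \<epsilon>_def d_def of_nat_diff)
    have b1: "(s, d, b) \<in> plane q" "((s, a, b), (s, d, b)) \<in> ?R\<^sup>*"
      using two[OF that(1), of 0 d] that(1) d by (simp_all add: plane_nb_nb plane_def)
    define c where "c = nat ((\<epsilon> * (b' - b)) mod int q)"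
    have c: "c < q" "int c = (\<epsilon> * (b' - b)) mod int q"
      using assms(1) by (auto simp: c_def nat_less_iff)
    have "(b + int c * \<epsilon>) mod int q = (b + (\<epsilon> * (b' - b)) * \<epsilon>) mod int q"
      unfolding c(2) by (rule mod_add_cong[OF refl mod_mult_left_eq])
    also have "(\<epsilon> * (b' - b)) * \<epsilon> = (\<epsilon> * \<epsilon>) * (b' - b)" by (simp add: mult_ac)
    finally have "(b + int c * \<epsilon>) mod int q = b'"
      using eps that(2) by (simp add: plane_def)
    then have "plane_nb q (plane_nb q (s, d, b) c) a' = (s, a', b')"
      by (simp add: plane_nb_nb \<epsilon>_def)
    then have "((s, d, b), (s, a', b')) \<in> ?R\<^sup>*"
      using two[OF b1(1) c(1), of a'] that(2) by (simp add: plane_def)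
    then show ?thesis using b1(2) by (rule rtrancl_trans[rotated])
  qed
  obtain s a b where u: "u = (s, a, b)" by (cases u)
  obtain s' a' b' where v: "v = (s', a', b')" by (cases v)
  show ?thesis
  proof (cases "s = s'")
    case True
    then show ?thesis using same_side assms u v by simp
  next
    case False
    then have eq: "plane_nb q u 0 = (s', 0, (- b) mod int q)"
      using u by (simp add: plane_nb_def)
    have "(u, plane_nb q u 0) \<in> ?R\<^sup>*"
      using assms(1) by (intro nb[OF assms(2)]) simp
    also have "(plane_nb q u 0, v) \<in> ?R\<^sup>*"
      unfolding eq v
    proof (rule same_side)
      show "(s', 0, (- b) mod int q) \<in> plane q"
        using in_plane[of 0 u] assms(1) unfolding eq by simp
      show "(s', a', b') \<in> plane q"
        using assms(3) unfolding v .
    qed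
    finally show ?thesis .
  qed
qed

text \<open>\<open>2 * q\<close> is the least value of \<open>L\<close> that the locale admits,
  which keeps the order of the expansion at \<open>O(q^4)\<close>.\<close>

lemma expansion_plane:
  assumes q: "prime q"
  shows "expansion (plane q) q (2 * q) (plane_nb q) plane_pt"
proof
  have q2: "2 \<le> q" using q by (rule prime_ge_2_nat)
  show "2 \<le> q" by fact
  show "finite (plane q)" by (simp add: plane_def)
  have "(True, 0, 0) \<in> plane q" using q2 by (simp add: plane_def)
  then show "plane q \<noteq> {}" by blast
  show "(u, v) \<in> {(x, y). x \<in> plane q \<and> (\<exists>c<q. y = plane_nb q x c)}\<^sup>*"
    if "u \<in> plane q" "v \<in> plane q" for u v
    using plane_connected that q2 by simp
  show "b = b'" if "w \<in> plane q" "b < q" "c < q" "b' < q" "c' < q"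
    "plane_nb q (plane_nb q w b) c = plane_nb q (plane_nb q w b') c'"
    "plane_nb q (plane_nb q w b) c \<noteq> w" for w b c b' c'
    using that plane_no_square[OF q] by (cases w) (auto simp: plane_def)
  \<comment> \<open>Two steps keep the side of the bipartition, one step changes it.\<close>
  show "plane_nb q (plane_nb q w b) c \<noteq> plane_nb q w d" for w b c d
    by (auto simp: plane_nb_def split: prod.splits)
  show "plane_nb q w c \<in> plane q" if "c < q" for w c
    using that by (auto simp: plane_nb_def plane_def split: prod.splits)
  show "plane_nb q (plane_nb q w c) (plane_pt w c) = w" if "w \<in> plane q" for w c
    using that by (cases w) (simp add: plane_nb_nb plane_pt_def plane_def)
qed (auto simp: plane_nb_def plane_def plane_pt_def split: prod.splits)

section \<open>The cubic graphs and the final estimate\<close>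

lemma cubic_graph_family:
  assumes q: "prime q"
  shows "\<exists>(V :: nat set) E. simple_graph V E \<and> connected_graph V E \<and> cubic_graph V E \<and>
    card V = 4 * q ^ 3 * (2 * q + 1) \<and> q \<le> 2 * containability_number V E + 1"
proof -
  interpret expansion "plane q" q "2 * q" "plane_nb q" plane_pt
    using q by (rule expansion_plane)
  let ?f = "to_nat :: _ \<Rightarrow> nat"
  let ?V = "?f ` V" and ?E = "(`) ?f ` E"
  have f: "inj ?f" by simp
  have card_plane: "card (plane q) = 2 * q * q"
    by (simp add: plane_def card_cartesian_product)
  have simple: "simple_graph ?V ?E"
    using f simple_graph by (rule simple_graph_image)
  have "card ?V = 4 * q ^ 3 * (2 * q + 1)"
    using card_image[of ?f V] by (simp add: card_V card_plane power3_eq_cube inj_on_subset)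
  moreover have "q \<le> 2 * containability_number ?V ?E + 1"
  proof (rule ccontr)
    assume less: "\<not> ?thesis"
    have "containable ?V ?E (containability_number ?V ?E)"
      unfolding containability_number_def
      using containable_card_edges[OF simple] by (rule LeastI)
    then have "containable V E (containability_number ?V ?E)"
      using f by (rule containable_image[rotated])
    then show False
      using not_containable less card_plane q_ge by simp
  qed
  ultimately show ?thesis
    using simple connected_graph_image[OF connected_graph] cubic_graph_image[OF f cubic_graph] by blast
qed

theorem theorem3p10:
  "\<exists>C::real. C > 0 \<and>
     infinite {n::nat. n > 0 \<and>
       (\<exists>(V :: nat set) (E :: nat set set).
          simple_graph V E \<and> connected_graph V E \<and> cubic_graph V E \<and> card V = n \<and>
          real (containability_number V E) \<ge> C * real n powr (1/6))}"
proof (intro exI conjI)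
  let ?n = "\<lambda>q::nat. 4 * q ^ 3 * (2 * q + 1)"
  let ?S = "{n::nat. n > 0 \<and>
       (\<exists>(V :: nat set) (E :: nat set set).
          simple_graph V E \<and> connected_graph V E \<and> cubic_graph V E \<and> card V = n \<and>
          real (containability_number V E) \<ge> 1/8 * real n powr (1/6))}"
  \<comment> \<open>The value \<open>1/8\<close> works because the sixth root of the order is at
    most \<open>2 * q\<close>, and \<open>q / 4 \<le> (q - 1) / 2\<close> once \<open>q\<close> is
    at least two.\<close>
  show "(1/8 :: real) > 0" by simp
  have "?n q \<in> ?S" if q: "prime q" for q
  proof -
    have q2: "2 \<le> q" using q by (rule prime_ge_2_nat)
    obtain V :: "nat set" and E where VE: "simple_graph V E" "connected_graph V E" "cubic_graph V E"
      "card V = ?n q" "q \<le> 2 * containability_number V E + 1"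
      using cubic_graph_family[OF q] by blast
    \<comment> \<open>The order is bounded generously by \<open>8 * q ^ 6\<close>, so that the sixth
      root can be taken exactly from \<open>(2 * q) ^ 6\<close>.\<close>
    have "?n q \<le> 4 * q ^ 3 * (q ^ 3 * 2)"
    proof (intro mult_left_mono)
      have "2 * 2 \<le> q * q" using q2 by (intro mult_mono) auto
      then have "q * 4 \<le> q * (q * q)" by simp
      also have "\<dots> = q ^ 3" by (simp add: power3_eq_cube)
      finally show "2 * q + 1 \<le> q ^ 3 * 2" using q2 by linarith
    qed auto
    also have "\<dots> \<le> (2 * q) ^ 6"
      by (simp add: power_mult_distrib flip: power_add)
    finally have "real (?n q) \<le> real ((2 * q) ^ 6)"
      by (simp only: of_nat_le_iff)
    then have "real (?n q) powr (1/6) \<le> (real (2 * q) ^ 6) powr (1/6)"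
      by (intro powr_mono2) auto
    also have "real (2 * q) ^ 6 = real (2 * q) powr 6"
      using q2 by (subst powr_numeral) simp_all
    also have "(real (2 * q) powr 6) powr (1/6) = 2 * real q"
      by (subst powr_powr) simp
    finally have "1/8 * real (?n q) powr (1/6) \<le> 1/4 * real q"
      by simp
    also have "\<dots> \<le> real (containability_number V E)"
      using VE(5) q2 by linarith
    finally have "1/8 * real (?n q) powr (1/6) \<le> real (containability_number V E)" .
    then show ?thesis
      unfolding mem_Collect_eq using VE(1-4) q2
      by (intro conjI exI[of _ V] exI[of _ E]) simp_all
  qed
  then have "?n ` {q. prime q} \<subseteq> ?S" by blast
  moreover have "infinite (?n ` {q. prime q})"
  proof -
    \<comment> \<open>Distinct primes give distinct orders, so the infinitude of primes yields
      infinitely many orders.\<close>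
    have "strict_mono ?n"
    proof (rule strict_monoI)
      fix x y :: nat
      assume "x < y"
      then have "x ^ 3 < y ^ 3"
        by (intro power_strict_mono) simp_all
      with \<open>x < y\<close> show "?n x < ?n y"
        by (intro mult_strict_mono[of "4 * x ^ 3"]) simp_all
    qed
    then have "inj_on ?n {q. prime q}"
      by (meson strict_mono_imp_inj_on inj_on_subset subset_UNIV)
    then show ?thesis
      using primes_infinite by (simp add: finite_image_iff)
  qed
  ultimately show "infinite ?S"
    by (rule infinite_super)
qed

end
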